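(* Let $\mu$ be a non-degenerate probability measure supported on $[0,1]$ and symmetric about the line $u=1/2$, and let $X$ be a random variable distributed according to $\mu$. Let $H_1$ be a single edge and $H_2$ a finite simple graph with $p\ge 2$ edges, and suppose that the equation $K'''(\theta)K'(\theta)=-(p-2)\left(K''(\theta)\right)^2$ has exactly one solution $\theta\in\mathbb{R}$, where $K(\theta)=\log\int e^{\theta x}\mu(dx)$. Then the phase transition curve $\beta_2=r(\beta_1)$ of the associated $2$-parameter edge-weighted exponential random graph model lies above the straight line $\beta_2=-\beta_1$ when $p\ge 3$, and is exactly the portion $\beta_1\le -1/(4\operatorname{Var}(X))$ of the straight line $\beta_2=-\beta_1$ when $p=2$.
   Context: Let $I(u)=\sup_{\theta\in\mathbb{R}}\{\theta u-K(\theta)\}$ and, for $\beta_2\ge0$, $L(u;\beta_1,\beta_2)=\beta_1u+\beta_2u^p-\frac12I(u)$ for $u$ in the domain $\{I<\infty\}$. The limiting normalization constant of the $2$-parameter edge-weighted exponential random graph model with parameters $\beta=(\beta_1,\beta_2)$, edge-weight distribution $\mu$ and subgraphs $H_1,H_2$ is $\psi_\infty^\beta=\sup_uL(u;\beta_1,\beta_2)$. Phase transition curve: let $\theta_0$ be the unique solution of $K'''(\theta)K'(\theta)=-(p-2)(K''(\theta))^2$ and put $u_0=K'(\theta_0)$, $\beta_2^c=\frac{I''(u_0)}{2p(p-1)u_0^{p-2}}=\frac{1}{2p(p-1)K''(\theta_0)K'(\theta_0)^{p-2}}$ and $\beta_1^c=-\left(\frac{u_0I''(u_0)}{2(p-1)}-\frac12I'(u_0)\right)=\frac{\theta_0}{2}-\frac{K'(\theta_0)}{2(p-1)K''(\theta_0)}$.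 For $\beta_1<\beta_1^c$, $r(\beta_1)$ is the unique value of $\beta_2\ge 0$ for which $L(\cdot;\beta_1,\beta_2)$ has two distinct global maximizers; also $r(\beta_1^c)=\beta_2^c$. The phase transition curve is $\{(\beta_1,r(\beta_1)):\beta_1\le\beta_1^c\}$, a decreasing curve with endpoint the critical point $(\beta_1^c,\beta_2^c)$; off this curve $L(\cdot;\beta_1,\beta_2)$ has a unique global maximizer. *)

theory Defs
  imports "HOL-Probability.Probability"
begin

type_synonym 'a graph = "'a set \<times> 'a set set"

definition finite_simple_graph :: "'a graph \<Rightarrow> bool" where
  "finite_simple_graph H \<longleftrightarrow> finite (fst H) \<and> (\<forall>e\<in>snd H. e \<subseteq> fst H \<and> card e = 2)"

definition num_edges :: "'a graph \<Rightarrow> nat" where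
  "num_edges H = card (snd H)"

definition single_edge :: "'a graph \<Rightarrow> bool" where
  "single_edge H \<longleftrightarrow> (\<exists>a b. a \<noteq> b \<and> H = ({a, b}, {{a, b}}))"

definition cgf :: "real measure \<Rightarrow> real \<Rightarrow> real" where
  "cgf \<mu> \<theta> = ln (\<integral>x. exp (\<theta> * x) \<partial>\<mu>)"

definition rate :: "real measure \<Rightarrow> real \<Rightarrow> ereal" where
  "rate \<mu> u = (SUP \<theta>::real. ereal (\<theta> * u - cgf \<mu> \<theta>))"

definition rate_dom :: "real measure \<Rightarrow> real set" where
  "rate_dom \<mu> = {u. rate \<mu> u < \<infinity>}"

text \<open>Each subgraph contributes its number of edges as an exponent, so the first term is
  \<open>\<beta>1 * u\<close> when \<open>H1\<close> is a single edge. The conversion to reals is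
  meaningful only on \<open>rate_dom \<mu>\<close>, where the rate is finite (it is never
  \<open>-\<infinity>\<close>).\<close>

definition ergm_L ::
    "real measure \<Rightarrow> 'a graph \<Rightarrow> 'b graph \<Rightarrow> real \<Rightarrow> real \<Rightarrow> real \<Rightarrow> real" where
  "ergm_L \<mu> H1 H2 \<beta>1 \<beta>2 u =
     \<beta>1 * u ^ num_edges H1 + \<beta>2 * u ^ num_edges H2 - real_of_ereal (rate \<mu> u) / 2"

definition global_maximizer ::
    "real measure \<Rightarrow> 'a graph \<Rightarrow> 'b graph \<Rightarrow> real \<Rightarrow> real \<Rightarrow> real \<Rightarrow> bool" where
  "global_maximizer \<mu> H1 H2 \<beta>1 \<beta>2 u \<longleftrightarrow>
     u \<in> rate_dom \<mu> \<and>
     (\<forall>v\<in>rate_dom \<mu>. ergm_L \<mu> H1 H2 \<beta>1 \<beta>2 v \<le> ergm_L \<mu> H1 H2 \<beta>1 \<beta>2 u)"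

text \<open>From here on \<open>p\<close> is the number of edges of \<open>H2\<close>, \<open>p \<ge> 2\<close>, and \<open>H1\<close> is a
  single edge.\<close>

definition critical_eq :: "real measure \<Rightarrow> nat \<Rightarrow> real \<Rightarrow> bool" where
  "critical_eq \<mu> p \<theta> \<longleftrightarrow>
     (deriv ^^ 3) (cgf \<mu>) \<theta> * deriv (cgf \<mu>) \<theta>
       = - (real p - 2) * ((deriv ^^ 2) (cgf \<mu>) \<theta>)\<^sup>2"

definition theta0 :: "real measure \<Rightarrow> nat \<Rightarrow> real" where
  "theta0 \<mu> p = (THE \<theta>. critical_eq \<mu> p \<theta>)"

definition beta1_crit :: "real measure \<Rightarrow> nat \<Rightarrow> real" where
  "beta1_crit \<mu> p =
     theta0 \<mu> p / 2
     - deriv (cgf \<mu>) (theta0 \<mu> p)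
       / (2 * (real p - 1) * (deriv ^^ 2) (cgf \<mu>) (theta0 \<mu> p))"

definition beta2_crit :: "real measure \<Rightarrow> nat \<Rightarrow> real" where
  "beta2_crit \<mu> p =
     1 / (2 * real p * (real p - 1) * (deriv ^^ 2) (cgf \<mu>) (theta0 \<mu> p)
            * deriv (cgf \<mu>) (theta0 \<mu> p) ^ (p - 2))"

text \<open>Only the values for \<open>\<beta>1 \<le> beta1_crit\<close> are meaningful.\<close>

definition transition_r ::
    "real measure \<Rightarrow> 'a graph \<Rightarrow> 'b graph \<Rightarrow> real \<Rightarrow> real" where
  "transition_r \<mu> H1 H2 \<beta>1 =
     (if \<beta>1 < beta1_crit \<mu> (num_edges H2)
      then (THE \<beta>2. 0 \<le> \<beta>2 \<and>
              (\<exists>u v. u \<noteq> v \<and> global_maximizer \<mu> H1 H2 \<beta>1 \<beta>2 u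
                           \<and> global_maximizer \<mu> H1 H2 \<beta>1 \<beta>2 v))
      else beta2_crit \<mu> (num_edges H2))"

definition phase_transition_curve ::
    "real measure \<Rightarrow> 'a graph \<Rightarrow> 'b graph \<Rightarrow> (real \<times> real) set" where
  "phase_transition_curve \<mu> H1 H2 =
     {(\<beta>1, transition_r \<mu> H1 H2 \<beta>1) | \<beta>1. \<beta>1 \<le> beta1_crit \<mu> (num_edges H2)}"

end

theory Submission imports Defs begin

text \<open>
  Write \<open>K\<close> for the cumulant generating function of \<open>\<mu>\<close>. The mean \<open>K' \<theta>\<close> of the law tilted by
  \<open>\<theta>\<close> parametrizes the interior of the domain of the rate function, where the rate is
  \<open>\<theta> * K' \<theta> - K \<theta>\<close>; the end points of the domain never maximize, because the slope of the
  rate becomes infinite there (lemmas \<open>boundary_not_maximal\<close> and \<open>global_maximizer_iff\<close>). So the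
  objective may be studied as a function of \<open>\<theta>\<close>, with derivative
  \<open>K'' \<theta> * (\<beta>1 + p * \<beta>2 * K' \<theta> ^ (p - 1) - \<theta> / 2)\<close>: its stationary points are the
  intersections of a line with the curve \<open>K' ^ (p - 1)\<close>.

  The critical equation has \<open>\<theta>\<^sub>0\<close> as its only root exactly when \<open>\<theta>\<^sub>0\<close> is the only zero of the
  second derivative of this curve. As the curve is bounded and increasing, it is then S-shaped: its
  slope increases strictly up to \<open>\<theta>\<^sub>0\<close> and decreases strictly afterwards. By Rolle's theorem two
  distinct maximizers lie on opposite sides of \<open>\<theta>\<^sub>0\<close> (\<open>maximizers_straddle\<close>). Maximizers also
  move to the right as \<open>\<beta>2\<close> grows, so at most one \<open>\<beta>2\<close> admits two of them. For \<open>\<beta>1\<close> below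
  its critical value one such \<open>\<beta>2\<close> exists: the maximum over the parameters left of \<open>\<theta>\<^sub>0\<close> wins
  at \<open>\<beta>2 = 0\<close>, the maximum over those on the right wins for large \<open>\<beta>2\<close>, and where the two agree
  \<open>\<theta>\<^sub>0\<close> itself is not a maximizer (\<open>two_maximizers_exist\<close>). This determines the transition curve.

  For \<open>p = 2\<close> and \<open>\<beta>2 = - \<beta>1\<close> the objective is \<open>\<beta>1 * u * (1 - u)\<close> minus half the rate, which
  is symmetric about \<open>1 / 2\<close>, and \<open>\<theta>\<^sub>0 = 0\<close> corresponds to the centre \<open>u = 1 / 2\<close>. A
  maximizer off the centre comes with its mirror image, so the curve follows the line
  \<open>\<beta>2 = - \<beta>1\<close> up to the critical point, which is read off from the variance \<open>K'' 0\<close>.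

  For \<open>p \<ge> 3\<close> we have \<open>\<theta>\<^sub>0 > 0\<close>. If \<open>0 < \<beta>2 \<le> - \<beta>1\<close>, reflecting a point right of
  \<open>1 / 2\<close> strictly increases the objective, so all maximizers have \<open>\<theta> \<le> 0 < \<theta>\<^sub>0\<close> and cannot
  straddle \<open>\<theta>\<^sub>0\<close>. Hence two maximizers force \<open>\<beta>2 > - \<beta>1\<close>. At the critical point the claim is
  that the tangent to the S-shaped curve at \<open>\<theta>\<^sub>0\<close> passes below the height \<open>1 / p\<close> at \<open>0\<close>. The
  curve is strictly convex on \<open>{0..\<theta>\<^sub>0}\<close> and starts at height \<open>1 / 2 ^ (p - 1) \<le> 1 / p\<close>, so it
  does.
\<close>

section \<open>Two inequalities for powers\<close>

lemma power_diff_le: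
  fixes u v :: real
  assumes "0 \<le> v" "v \<le> u" "u \<le> 1"
  shows "u ^ p - v ^ p \<le> real p * (u - v)"
proof (induction p)
  case (Suc p)
  have "u ^ Suc p - v ^ Suc p = u * (u ^ p - v ^ p) + (u - v) * v ^ p"
    by (simp add: algebra_simps)
  also have "\<dots> \<le> 1 * (u ^ p - v ^ p) + (u - v) * 1"
    using assms by (intro add_mono mult_mono mult_left_mono) (auto simp: power_mono power_le_one)
  finally show ?case using Suc by (simp add: algebra_simps)
qed simp

text \<open>The line \<open>2 * u - 1\<close> is the chord of \<open>u ^ n - (1 - u) ^ n\<close> over \<open>{1 / 2..1}\<close>, where this
  function is strictly convex.\<close>

lemma power_antisymmetric_less:
  fixes u :: real
  assumes "1 / 2 < u" "u < 1" "3 \<le> n"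
  shows "u ^ n - (1 - u) ^ n < 2 * u - 1"
  using assms(3)
proof (induction n rule: dec_induct)
  case base
  have "2 * u - 1 - (u ^ 3 - (1 - u) ^ 3) = u * (1 - u) * (2 * u - 1)"
    by (simp add: power3_eq_cube algebra_simps)
  moreover have "0 < u * (1 - u) * (2 * u - 1)" using assms by simp
  ultimately show ?case by linarith
next
  case (step n)
  have "(1 - u) ^ n * (2 * u - 1) \<le> (1 - u) * (2 * u - 1)"
    using assms step by (intro mult_right_mono) (auto intro: power_le_one_iff[THEN iffD2] simp: power_decreasing[of 1 n "1 - u", simplified])
  have "u ^ Suc n - (1 - u) ^ Suc n = u * (u ^ n - (1 - u) ^ n) + (1 - u) ^ n * (2 * u - 1)"
    by (simp add: algebra_simps)
  also have "\<dots> < u * (2 * u - 1) + (1 - u) * (2 * u - 1)"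
    using step(3) assms \<open>_ \<le> (1 - u) * (2 * u - 1)\<close> by (intro add_less_le_mono mult_strict_left_mono) auto
  also have "\<dots> = 2 * u - 1" by (simp add: algebra_simps)
  finally show ?case .
qed

section \<open>Exponential tilting of laws on the unit interval\<close>

locale unit_distribution = real_distribution \<mu> for \<mu> :: "real measure" +
  assumes supported: "AE x in \<mu>. x \<in> {0..1}"
begin

definition tilted_moment :: "nat \<Rightarrow> real \<Rightarrow> real" where
  "tilted_moment k \<theta> = (\<integral>x. x ^ k * exp (\<theta> * x) \<partial>\<mu>)"

lemma prob_UNIV: "prob UNIV = 1"
  using prob_space by simp

lemma integrable_power: "integrable \<mu> (\<lambda>x. x ^ k)"
proof (rule integrable_const_bound[where B = 1])
  show "AE x in \<mu>. norm (x ^ k) \<le> 1"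
    using supported by eventually_elim (auto simp: power_le_one)
qed auto

lemma moment_bounds: "0 \<le> (\<integral>x. x ^ k \<partial>\<mu>)" "(\<integral>x. x ^ k \<partial>\<mu>) \<le> 1"
proof -
  have "AE x in \<mu>. 0 \<le> x ^ k" "AE x in \<mu>. x ^ k \<le> 1"
    using supported by (eventually_elim, auto simp: power_le_one)+
  then show "0 \<le> (\<integral>x. x ^ k \<partial>\<mu>)"
    by (intro integral_nonneg_AE)
  have "(\<integral>x. x ^ k \<partial>\<mu>) \<le> (\<integral>x. 1 \<partial>\<mu>)"
    using \<open>AE x in \<mu>. x ^ k \<le> 1\<close>
    by (intro integral_mono_AE integrable_power) auto
  then show "(\<integral>x. x ^ k \<partial>\<mu>) \<le> 1" by (simp add: prob_UNIV)
qed

lemma integrable_tilted: "integrable \<mu> (\<lambda>x. x ^ k * exp (\<theta> * x))"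
proof (rule integrable_const_bound[where B = "exp \<bar>\<theta>\<bar>"])
  show "AE x in \<mu>. norm (x ^ k * exp (\<theta> * x)) \<le> exp \<bar>\<theta>\<bar>"
    using supported
  proof eventually_elim
    case (elim x)
    then have "\<theta> * x \<le> \<bar>\<theta>\<bar> * 1" by (intro mult_mono) auto
    moreover have "x ^ k \<le> 1" using elim by (simp add: power_le_one)
    ultimately have "x ^ k * exp (\<theta> * x) \<le> 1 * exp \<bar>\<theta>\<bar>" by (intro mult_mono) auto
    then show ?case using elim by (simp add: abs_mult)
  qed
qed auto

text \<open>Differentiation under the integral sign is done through power series: the moments are bounded
  by \<open>1\<close>, so the moment series converges everywhere and may be differentiated term by term.\<close>

lemma moment_series_summable: "summable (\<lambda>n. (\<integral>x. x ^ (n + k) \<partial>\<mu>) / fact n * y ^ n)"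
proof (rule summable_comparison_test')
  show "summable (\<lambda>n. inverse (fact n) * \<bar>y\<bar> ^ n)" by (rule summable_exp)
  show "norm ((\<integral>x. x ^ (n + k) \<partial>\<mu>) / fact n * y ^ n) \<le> inverse (fact n) * \<bar>y\<bar> ^ n" for n
    using mult_right_mono[OF moment_bounds(2)[of "n + k"], of "\<bar>y\<bar> ^ n / fact n"]
      moment_bounds(1)[of "n + k"]
    by (simp add: abs_mult power_abs field_simps)
qed

lemma tilted_moment_series:
  "tilted_moment k \<theta> = (\<Sum>n. (\<integral>x. x ^ (n + k) \<partial>\<mu>) / fact n * \<theta> ^ n)"
proof -
  let ?f = "\<lambda>n x. x ^ (n + k) * (\<theta> ^ n / fact n)"
  have term_eq: "(\<integral>x. ?f n x \<partial>\<mu>) = (\<integral>x. x ^ (n + k) \<partial>\<mu>) / fact n * \<theta> ^ n" for n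
    by simp
  have int: "integrable \<mu> (?f n)" for n by (intro integrable_mult_left integrable_power)
  have "(\<integral>x. (\<Sum>n. ?f n x) \<partial>\<mu>) = (\<Sum>n. \<integral>x. ?f n x \<partial>\<mu>)"
  proof (rule integral_suminf[OF int])
    show "AE x in \<mu>. summable (\<lambda>n. norm (?f n x))"
      using supported
    proof eventually_elim
      case (elim x)
      show ?case
      proof (rule summable_comparison_test'[OF summable_exp[of "\<bar>\<theta>\<bar>"]])
        show "norm (norm (?f n x)) \<le> inverse (fact n) * \<bar>\<theta>\<bar> ^ n" for n
          using elim mult_right_mono[of "x ^ (n + k)" 1 "\<bar>\<theta>\<bar> ^ n / fact n"]
          by (simp add: abs_mult power_abs field_simps power_le_one)
      qed
    qed
    have "(\<integral>x. norm (?f n x) \<partial>\<mu>) = (\<integral>x. x ^ (n + k) \<partial>\<mu>) / fact n * \<bar>\<theta>\<bar> ^ n" for n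
    proof -
      have "(\<integral>x. norm (?f n x) \<partial>\<mu>) = (\<integral>x. x ^ (n + k) * (\<bar>\<theta>\<bar> ^ n / fact n) \<partial>\<mu>)"
      proof (rule integral_cong_AE)
        show "AE x in \<mu>. norm (?f n x) = x ^ (n + k) * (\<bar>\<theta>\<bar> ^ n / fact n)"
          using supported by eventually_elim (auto simp: abs_mult power_abs)
      qed auto
      then show ?thesis by simp
    qed
    then show "summable (\<lambda>n. \<integral>x. norm (?f n x) \<partial>\<mu>)"
      using moment_series_summable[of k "\<bar>\<theta>\<bar>"] by simp
  qed
  moreover have "(\<Sum>n. ?f n x) = x ^ k * exp (\<theta> * x)" for x
  proof -
    have "(\<lambda>n. x ^ k * ((\<theta> * x) ^ n /\<^sub>R fact n)) sums (x ^ k * exp (\<theta> * x))"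
      by (intro sums_mult exp_converges)
    then show ?thesis
      by (simp add: sums_iff power_add power_mult_distrib field_simps)
  qed
  ultimately show ?thesis
    by (simp add: tilted_moment_def term_eq)
qed

lemma tilted_moment_has_derivative:
  "(tilted_moment k has_real_derivative tilted_moment (Suc k) \<theta>) (at \<theta>)"
proof -
  let ?c = "\<lambda>n. (\<integral>x. x ^ (n + k) \<partial>\<mu>) / fact n"
  have "diffs ?c n = (\<integral>x. x ^ (n + Suc k) \<partial>\<mu>) / fact n" for n
    by (simp add: diffs_def fact_Suc del: of_nat_Suc)
  then show ?thesis
    using termdiffs_strong_converges_everywhere[OF moment_series_summable, of k \<theta>]
    unfolding tilted_moment_series[abs_def] by simp
qed

lemma tilted_moment_0_pos: "0 < tilted_moment 0 \<theta>"
proof -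
  have "0 < (\<integral>x. exp (\<theta> * x) \<partial>\<mu>)"
  proof (rule integral_less_AE_space[of "\<lambda>_. 0", simplified])
    show "integrable \<mu> (\<lambda>x. exp (\<theta> * x))" using integrable_tilted[of 0 \<theta>] by simp
    show "AE x in \<mu>. 0 < exp (\<theta> * x)" by (intro AE_I2) simp
    show "emeasure \<mu> UNIV \<noteq> 0" using emeasure_space_1 by simp
  qed
  then show ?thesis by (simp add: tilted_moment_def)
qed

text \<open>Mean, variance and third cumulant of the exponentially tilted law with density
  proportional to \<open>exp (\<theta> * x)\<close>; they turn out to be the first three derivatives of the
  cumulant generating function.\<close>

definition cgf1 :: "real \<Rightarrow> real" where
  "cgf1 \<theta> = tilted_moment 1 \<theta> / tilted_moment 0 \<theta>"

definition cgf2 :: "real \<Rightarrow> real" where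
  "cgf2 \<theta> = tilted_moment 2 \<theta> / tilted_moment 0 \<theta> - (cgf1 \<theta>)\<^sup>2"

definition cgf3 :: "real \<Rightarrow> real" where
  "cgf3 \<theta> = tilted_moment 3 \<theta> / tilted_moment 0 \<theta>
     - tilted_moment 2 \<theta> * tilted_moment 1 \<theta> / (tilted_moment 0 \<theta>)\<^sup>2 - 2 * cgf1 \<theta> * cgf2 \<theta>"

lemma cgf_eq: "cgf \<mu> \<theta> = ln (tilted_moment 0 \<theta>)"
  by (simp add: cgf_def tilted_moment_def)

lemma cgf_has_derivative: "(cgf \<mu> has_real_derivative cgf1 \<theta>) (at \<theta>)"
  unfolding cgf_eq[abs_def] cgf1_def using tilted_moment_0_pos[of \<theta>]
  by (auto intro!: derivative_eq_intros tilted_moment_has_derivative simp: field_simps)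

lemma cgf1_has_derivative: "(cgf1 has_real_derivative cgf2 \<theta>) (at \<theta>)"
  unfolding cgf1_def[abs_def] cgf2_def using tilted_moment_0_pos[of \<theta>]
  by (auto intro!: derivative_eq_intros tilted_moment_has_derivative
      simp: field_simps power2_eq_square numeral_2_eq_2)

lemma cgf2_has_derivative: "(cgf2 has_real_derivative cgf3 \<theta>) (at \<theta>)"
proof -
  let ?M = "\<lambda>k. tilted_moment k \<theta>"
  have "((\<lambda>\<theta>. tilted_moment 2 \<theta> / tilted_moment 0 \<theta> - (cgf1 \<theta>)\<^sup>2) has_real_derivative
      (?M 3 * ?M 0 - ?M 2 * ?M 1) / (?M 0 * ?M 0) - 2 * cgf1 \<theta> * cgf2 \<theta>) (at \<theta>)"
    using tilted_moment_0_pos[of \<theta>] tilted_moment_has_derivative[of 2 \<theta>]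
    by (auto intro!: derivative_eq_intros tilted_moment_has_derivative cgf1_has_derivative
        simp: numeral_3_eq_3 numeral_2_eq_2)
  then show ?thesis
    using tilted_moment_0_pos[of \<theta>]
    by (simp add: cgf2_def[abs_def] cgf3_def[of \<theta>] diff_divide_distrib power2_eq_square)
qed

lemma deriv_cgf:
  "deriv (cgf \<mu>) = cgf1" "(deriv ^^ 2) (cgf \<mu>) = cgf2" "(deriv ^^ 3) (cgf \<mu>) = cgf3"
proof -
  show 1: "deriv (cgf \<mu>) = cgf1" using DERIV_imp_deriv[OF cgf_has_derivative] by auto
  have 2: "deriv cgf1 = cgf2" using DERIV_imp_deriv[OF cgf1_has_derivative] by auto
  have 3: "deriv cgf2 = cgf3" using DERIV_imp_deriv[OF cgf2_has_derivative] by auto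
  show "(deriv ^^ 2) (cgf \<mu>) = cgf2" "(deriv ^^ 3) (cgf \<mu>) = cgf3"
    using 1 2 3 by (simp_all add: numeral_2_eq_2 numeral_3_eq_3)
qed

lemma continuous_cgf3: "continuous_on UNIV cgf3"
proof -
  have m: "continuous_on UNIV (tilted_moment k)" for k
    by (rule DERIV_continuous_on) (rule tilted_moment_has_derivative)
  have "continuous_on UNIV cgf1" "continuous_on UNIV cgf2"
    by (rule DERIV_continuous_on, rule cgf1_has_derivative cgf2_has_derivative)+
  then show ?thesis
    unfolding cgf3_def[abs_def] using tilted_moment_0_pos
    by (intro continuous_intros m) (auto simp: less_imp_neq[THEN not_sym])
qed

lemma tilted_expectation_pos:
  assumes "f \<in> borel_measurable borel" "AE x in \<mu>. 0 \<le> f x" "\<not> (AE x in \<mu>. f x = 0)"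
    and "integrable \<mu> (\<lambda>x. f x * exp (\<theta> * x))"
  shows "0 < (\<integral>x. f x * exp (\<theta> * x) \<partial>\<mu>)"
proof -
  have nn: "AE x in \<mu>. 0 \<le> f x * exp (\<theta> * x)"
    using assms(2) by eventually_elim auto
  then have "(\<integral>x. f x * exp (\<theta> * x) \<partial>\<mu>) \<noteq> 0"
    using integral_nonneg_eq_0_iff_AE[OF assms(4) nn] assms(3) by simp
  then show ?thesis using integral_nonneg_AE[OF nn] by simp
qed

end

section \<open>Cumulants of a symmetric law\<close>

locale symmetric_unit_distribution = unit_distribution +
  assumes symmetric: "distr \<mu> borel (\<lambda>x. 1 - x) = \<mu>"
    and nondegenerate: "\<not> (\<exists>c. AE x in \<mu>. x = c)"
begin

text \<open>Substituting \<open>1 - x\<close> for \<open>x\<close> reverses the tilt. Differentiating this identity gives the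
  symmetries of the cumulants below, in particular the vanishing of the third one at \<open>0\<close>.\<close>

lemma cgf_reflect: "cgf \<mu> (- \<theta>) = cgf \<mu> \<theta> - \<theta>"
proof -
  have "(\<integral>x. exp (- \<theta> * x) \<partial>\<mu>) = (\<integral>x. exp (- \<theta> * x) \<partial>distr \<mu> borel (\<lambda>x. 1 - x))"
    by (simp add: symmetric)
  also have "\<dots> = (\<integral>x. exp (- \<theta>) * exp (\<theta> * x) \<partial>\<mu>)"
    by (subst integral_distr) (auto simp: algebra_simps simp flip: exp_add)
  finally have "tilted_moment 0 (- \<theta>) = exp (- \<theta>) * tilted_moment 0 \<theta>"
    by (simp add: tilted_moment_def)
  then show ?thesis
    using tilted_moment_0_pos[of \<theta>] by (simp add: cgf_eq ln_mult)
qed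

lemma cgf1_reflect: "cgf1 (- \<theta>) = 1 - cgf1 \<theta>"
proof -
  have "((\<lambda>\<theta>. cgf \<mu> (- \<theta>)) has_real_derivative - cgf1 (- \<theta>)) (at \<theta>)"
    by (rule DERIV_mirror[THEN iffD1, OF cgf_has_derivative])
  moreover have "((\<lambda>\<theta>. cgf \<mu> (- \<theta>)) has_real_derivative cgf1 \<theta> - 1) (at \<theta>)"
    unfolding cgf_reflect by (auto intro!: derivative_eq_intros cgf_has_derivative)
  ultimately show ?thesis by (auto dest: DERIV_unique)
qed

lemma cgf2_reflect: "cgf2 (- \<theta>) = cgf2 \<theta>"
proof -
  have "((\<lambda>\<theta>. cgf1 (- \<theta>)) has_real_derivative - cgf2 (- \<theta>)) (at \<theta>)"
    by (rule DERIV_mirror[THEN iffD1, OF cgf1_has_derivative])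
  moreover have "((\<lambda>\<theta>. cgf1 (- \<theta>)) has_real_derivative - cgf2 \<theta>) (at \<theta>)"
    unfolding cgf1_reflect by (auto intro!: derivative_eq_intros cgf1_has_derivative)
  ultimately show ?thesis by (auto dest: DERIV_unique)
qed

lemma cgf1_0: "cgf1 0 = 1 / 2"
  using cgf1_reflect[of 0] by simp

lemma cgf3_0: "cgf3 0 = 0"
proof -
  have "((\<lambda>\<theta>. cgf2 (- \<theta>)) has_real_derivative - cgf3 (- 0)) (at 0)"
    by (rule DERIV_mirror[THEN iffD1, OF cgf2_has_derivative])
  then have "(cgf2 has_real_derivative - cgf3 0) (at 0)"
    by (simp add: cgf2_reflect)
  then have "cgf3 0 = - cgf3 0" by (rule DERIV_unique[OF cgf2_has_derivative])
  then show ?thesis by simp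
qed

text \<open>This is the variance of the tilted law, which has the same null sets as \<open>\<mu>\<close> and is
  therefore not concentrated at its mean.\<close>

lemma cgf2_pos: "0 < cgf2 \<theta>"
proof -
  let ?c = "cgf1 \<theta>" and ?M = "\<lambda>k. tilted_moment k \<theta>"
  let ?i = "\<lambda>x. x ^ 2 * exp (\<theta> * x) - 2 * ?c * (x ^ 1 * exp (\<theta> * x)) + ?c\<^sup>2 * (x ^ 0 * exp (\<theta> * x))"
  have eq: "(x - ?c)\<^sup>2 * exp (\<theta> * x) = ?i x" for x
    by (simp add: power2_diff algebra_simps)
  have int: "integrable \<mu> ?i"
    by (intro Bochner_Integration.integrable_add Bochner_Integration.integrable_diff
        integrable_mult_right integrable_tilted)
  have "0 < (\<integral>x. (x - ?c)\<^sup>2 * exp (\<theta> * x) \<partial>\<mu>)"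
    by (rule tilted_expectation_pos) (use nondegenerate int in \<open>auto simp: eq\<close>)
  also have "\<dots> = ?M 2 - 2 * ?c * ?M 1 + ?c\<^sup>2 * ?M 0"
    unfolding eq tilted_moment_def
    by (simp add: integrable_tilted integrable_tilted[of 1, simplified] integrable_tilted[of 0, simplified])
  also have "\<dots> = ?M 0 * cgf2 \<theta>"
    using tilted_moment_0_pos[of \<theta>] by (simp add: cgf2_def cgf1_def field_simps power2_eq_square)
  finally show ?thesis
    using tilted_moment_0_pos[of \<theta>] by (simp add: zero_less_mult_iff)
qed

lemma cgf1_pos: "0 < cgf1 \<theta>"
proof -
  have "0 < (\<integral>x. x * exp (\<theta> * x) \<partial>\<mu>)"
  proof (rule tilted_expectation_pos)
    show "AE x in \<mu>. 0 \<le> x" using supported by eventually_elim auto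
    show "\<not> (AE x in \<mu>. x = 0)" using nondegenerate by blast
    show "integrable \<mu> (\<lambda>x. x * exp (\<theta> * x))" using integrable_tilted[of 1] by simp
  qed simp
  then show ?thesis
    using tilted_moment_0_pos[of \<theta>] by (simp add: cgf1_def tilted_moment_def)
qed

lemma cgf1_less_1: "cgf1 \<theta> < 1"
  using cgf1_pos[of "- \<theta>"] by (simp add: cgf1_reflect)

lemma cgf1_strict_mono: "\<theta> < \<theta>' \<Longrightarrow> cgf1 \<theta> < cgf1 \<theta>'"
  by (rule DERIV_pos_imp_increasing) (use cgf1_has_derivative cgf2_pos in blast)+

lemma cgf1_le_iff: "cgf1 \<theta> \<le> cgf1 \<theta>' \<longleftrightarrow> \<theta> \<le> \<theta>'"
  by (rule strict_mono_less_eq) (simp add: strict_monoI cgf1_strict_mono)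

lemma cgf1_inject: "cgf1 \<theta> = cgf1 \<theta>' \<longleftrightarrow> \<theta> = \<theta>'"
  by (metis cgf1_le_iff order_antisym order_refl)

lemma cgf2_0: "cgf2 0 = variance (\<lambda>x. x)"
proof -
  have "tilted_moment 0 0 = 1" "tilted_moment 1 0 = expectation (\<lambda>x. x)"
    "tilted_moment 2 0 = expectation (\<lambda>x. x\<^sup>2)"
    by (simp_all add: tilted_moment_def prob_UNIV)
  then show ?thesis
    using variance_eq[of "\<lambda>x. x"] integrable_power[of 1] integrable_power[of 2]
    by (simp add: cgf2_def cgf1_def)
qed

end

section \<open>The rate function in the tilt parameter\<close>

context symmetric_unit_distribution
begin

lemma cgf_0: "cgf \<mu> 0 = 0"
  by (simp add: cgf_eq tilted_moment_def prob_UNIV)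

text \<open>Convexity: the graph of the cumulant generating function lies above its tangents.\<close>

lemma cgf_tangent: "cgf \<mu> \<theta> + (t - \<theta>) * cgf1 \<theta> \<le> cgf \<mu> t"
proof (cases "t \<le> \<theta>")
  case True
  then have "cgf \<mu> \<theta> - \<theta> * cgf1 \<theta> \<le> cgf \<mu> t - t * cgf1 \<theta>"
    by (intro DERIV_nonpos_imp_nonincreasing[of t \<theta> "\<lambda>s. cgf \<mu> s - s * cgf1 \<theta>"] exI conjI)
       (auto intro!: derivative_eq_intros cgf_has_derivative simp: cgf1_le_iff)
  then show ?thesis by (simp add: algebra_simps)
next
  case False
  then have "cgf \<mu> \<theta> - \<theta> * cgf1 \<theta> \<le> cgf \<mu> t - t * cgf1 \<theta>"
    by (intro DERIV_nonneg_imp_nondecreasing[of \<theta> t "\<lambda>s. cgf \<mu> s - s * cgf1 \<theta>"] exI conjI)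
       (auto intro!: derivative_eq_intros cgf_has_derivative simp: cgf1_le_iff)
  then show ?thesis by (simp add: algebra_simps)
qed

lemma cgf_le_max: "cgf \<mu> \<theta> \<le> max 0 \<theta>"
proof (cases "0 \<le> \<theta>")
  case True
  then have "\<theta> * cgf1 \<theta> \<le> \<theta>"
    using cgf1_less_1[of \<theta>] by (simp add: mult_left_le)
  then show ?thesis using cgf_tangent[of \<theta> 0] True by (simp add: cgf_0)
next
  case False
  then have "\<theta> * cgf1 \<theta> \<le> 0"
    using cgf1_pos[of \<theta>] by (simp add: mult_nonpos_nonneg)
  then show ?thesis using cgf_tangent[of \<theta> 0] by (simp add: cgf_0)
qed

text \<open>The rate at the mean of the tilted law, where the supremum defining it is attained at the
  tilt itself.\<close>

definition legendre :: "real \<Rightarrow> real" where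
  "legendre \<theta> = \<theta> * cgf1 \<theta> - cgf \<mu> \<theta>"

lemma legendre_nonneg: "0 \<le> legendre \<theta>"
  using cgf_tangent[of \<theta> 0] by (simp add: legendre_def cgf_0)

lemma legendre_reflect: "legendre (- \<theta>) = legendre \<theta>"
  by (simp add: legendre_def cgf1_reflect cgf_reflect algebra_simps)

lemma rate_cgf1: "rate \<mu> (cgf1 \<theta>) = ereal (legendre \<theta>)"
  unfolding rate_def legendre_def
proof (intro antisym SUP_least)
  show "ereal (t * cgf1 \<theta> - cgf \<mu> t) \<le> ereal (\<theta> * cgf1 \<theta> - cgf \<mu> \<theta>)" for t
    using cgf_tangent[of \<theta> t] by (simp add: algebra_simps)
qed (rule SUP_upper, simp)

lemma rate_ge: "ereal (\<theta> * u - cgf \<mu> \<theta>) \<le> rate \<mu> u"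
  unfolding rate_def by (rule SUP_upper) simp

lemma rate_dom_ge:
  assumes "u \<in> rate_dom \<mu>"
  shows "\<theta> * u - cgf \<mu> \<theta> \<le> real_of_ereal (rate \<mu> u)"
proof -
  have "rate \<mu> u \<noteq> \<infinity>" "rate \<mu> u \<noteq> -\<infinity>"
    using assms rate_ge[of 0 u] by (auto simp: rate_dom_def)
  then obtain r where "rate \<mu> u = ereal r" by (cases "rate \<mu> u") auto
  then show ?thesis using rate_ge[of \<theta> u] by simp
qed

text \<open>The cumulant generating function is at most \<open>max 0 \<theta>\<close>, so outside the unit interval the
  affine functions \<open>\<theta> * u - K \<theta>\<close> are unbounded along one of the two half-lines.\<close>

lemma rate_dom_subset_unit:
  assumes "u \<in> rate_dom \<mu>"
  shows "0 \<le> u" "u \<le> 1"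
proof -
  let ?I = "real_of_ereal (rate \<mu> u)"
  have I0: "0 \<le> ?I" using rate_dom_ge[OF assms, of 0] by (simp add: cgf_0)
  show "0 \<le> u"
  proof (rule ccontr)
    assume "\<not> 0 \<le> u"
    then have "(?I + 1) / u * u = ?I + 1" "(?I + 1) / u \<le> 0"
      using I0 by (auto simp: divide_nonneg_neg)
    then show False
      using rate_dom_ge[OF assms, of "(?I + 1) / u"] cgf_le_max[of "(?I + 1) / u"] by simp
  qed
  show "u \<le> 1"
  proof (rule ccontr)
    let ?t = "(?I + 1) / (u - 1)"
    assume "\<not> u \<le> 1"
    then have "?t * (u - 1) = ?I + 1" "0 \<le> ?t"
      using I0 by auto
    then show False
      using rate_dom_ge[OF assms, of ?t] cgf_le_max[of ?t] by (simp add: right_diff_distrib)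
  qed
qed

definition tilted_L :: "nat \<Rightarrow> real \<Rightarrow> real \<Rightarrow> real \<Rightarrow> real" where
  "tilted_L p \<beta>1 \<beta>2 \<theta> = \<beta>1 * cgf1 \<theta> + \<beta>2 * cgf1 \<theta> ^ p - legendre \<theta> / 2"

text \<open>The derivative of \<open>tilted_L\<close> divided by the positive factor \<open>cgf2\<close>.\<close>

definition stationarity :: "nat \<Rightarrow> real \<Rightarrow> real \<Rightarrow> real \<Rightarrow> real" where
  "stationarity p \<beta>1 \<beta>2 \<theta> = \<beta>1 + real p * \<beta>2 * cgf1 \<theta> ^ (p - 1) - \<theta> / 2"

definition tilted_maximizer :: "nat \<Rightarrow> real \<Rightarrow> real \<Rightarrow> real \<Rightarrow> bool" where
  "tilted_maximizer p \<beta>1 \<beta>2 \<theta> \<longleftrightarrow> (\<forall>t. tilted_L p \<beta>1 \<beta>2 t \<le> tilted_L p \<beta>1 \<beta>2 \<theta>)"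

text \<open>Such a \<open>u\<close> lies on one side of all tilted means. Moving from \<open>u\<close> to the mean with a tilt
  \<open>\<theta>\<close> directed towards \<open>u\<close> lowers the rate by at least \<open>\<bar>\<theta>\<bar>\<close> times the distance, whereas
  the polynomial terms decrease by at most a fixed multiple of the distance. A sufficiently large
  tilt therefore gives a strictly better point.\<close>

lemma boundary_not_maximal:
  assumes u: "u \<in> rate_dom \<mu>" and out: "u \<notin> range cgf1" and b2: "0 \<le> \<beta>2"
  shows "\<exists>\<theta>. \<beta>1 * u + \<beta>2 * u ^ p - real_of_ereal (rate \<mu> u) / 2 < tilted_L p \<beta>1 \<beta>2 \<theta>"
proof -
  let ?Lu = "\<beta>1 * u + \<beta>2 * u ^ p - real_of_ereal (rate \<mu> u) / 2"
  have gap: "(cgf1 \<theta> - u) * (\<beta>1 - \<theta> / 2) + \<beta>2 * (cgf1 \<theta> ^ p - u ^ p) \<le> tilted_L p \<beta>1 \<beta>2 \<theta> - ?Lu" for \<theta>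
    using rate_dom_ge[OF u, of \<theta>] by (simp add: tilted_L_def legendre_def field_simps)
  have cont: "isCont cgf1 x" for x
    using cgf1_has_derivative by (rule DERIV_isCont)
  have "\<not> (cgf1 a < u \<and> u < cgf1 b)" for a b
  proof
    assume ab: "cgf1 a < u \<and> u < cgf1 b"
    then have "a \<le> b" using cgf1_le_iff[of a b] by simp
    then obtain x where "cgf1 x = u"
      using IVT[of cgf1 a u b] ab cont by auto
    then show False using out by auto
  qed
  then consider "\<forall>\<theta>. u < cgf1 \<theta>" | "\<forall>\<theta>. cgf1 \<theta> < u"
    using out by (metis linorder_neqE_linordered_idom rangeI)
  then show ?thesis
  proof cases
    case 1
    let ?t = "2 * \<beta>1 - 1"
    have v: "u < cgf1 ?t" using 1 by blast
    have "0 \<le> \<beta>2 * (cgf1 ?t ^ p - u ^ p)"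
      using b2 v rate_dom_subset_unit[OF u] by (simp add: power_mono)
    then show ?thesis using gap[of ?t] v by (intro exI[of _ ?t]) (simp add: field_simps)
  next
    case 2
    let ?t = "2 * \<beta>1 + 2 * real p * \<beta>2 + 1"
    have v: "cgf1 ?t < u" using 2 by blast
    have "\<beta>2 * (u ^ p - cgf1 ?t ^ p) \<le> \<beta>2 * (real p * (u - cgf1 ?t))"
      using b2 v cgf1_pos[of ?t] rate_dom_subset_unit[OF u]
      by (intro mult_left_mono power_diff_le) auto
    then show ?thesis using gap[of ?t] v by (intro exI[of _ ?t]) (simp add: field_simps)
  qed
qed

lemma global_maximizer_iff:
  assumes H1: "single_edge H1" and H2: "num_edges H2 = p" and b2: "0 \<le> \<beta>2"
  shows "global_maximizer \<mu> H1 H2 \<beta>1 \<beta>2 u \<longleftrightarrow> (\<exists>\<theta>. u = cgf1 \<theta> \<and> tilted_maximizer p \<beta>1 \<beta>2 \<theta>)"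
proof -
  let ?L = "ergm_L \<mu> H1 H2 \<beta>1 \<beta>2"
  have "num_edges H1 = 1"
    using H1 by (auto simp: single_edge_def num_edges_def)
  then have L: "?L v = \<beta>1 * v + \<beta>2 * v ^ p - real_of_ereal (rate \<mu> v) / 2" for v
    by (simp add: ergm_L_def H2)
  have L_cgf1: "?L (cgf1 \<theta>) = tilted_L p \<beta>1 \<beta>2 \<theta>" for \<theta>
    by (simp add: L tilted_L_def rate_cgf1)
  have dom: "cgf1 \<theta> \<in> rate_dom \<mu>" for \<theta>
    by (simp add: rate_dom_def rate_cgf1)
  have better: "\<exists>\<theta>. ?L v < tilted_L p \<beta>1 \<beta>2 \<theta>" if "v \<in> rate_dom \<mu>" "v \<notin> range cgf1" for v
    unfolding L using boundary_not_maximal[OF that b2] .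
  show ?thesis
  proof
    assume max: "global_maximizer \<mu> H1 H2 \<beta>1 \<beta>2 u"
    then have u: "u \<in> rate_dom \<mu>" and le: "tilted_L p \<beta>1 \<beta>2 \<theta> \<le> ?L u" for \<theta>
      using dom[of \<theta>] by (auto simp: global_maximizer_def simp flip: L_cgf1)
    have "u \<in> range cgf1"
      using better[OF u] le by (meson not_less)
    then show "\<exists>\<theta>. u = cgf1 \<theta> \<and> tilted_maximizer p \<beta>1 \<beta>2 \<theta>"
      using le by (auto simp: tilted_maximizer_def L_cgf1)
  next
    assume "\<exists>\<theta>. u = cgf1 \<theta> \<and> tilted_maximizer p \<beta>1 \<beta>2 \<theta>"
    then obtain \<theta> where \<theta>: "u = cgf1 \<theta>" "\<And>t. tilted_L p \<beta>1 \<beta>2 t \<le> tilted_L p \<beta>1 \<beta>2 \<theta>"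
      by (auto simp: tilted_maximizer_def)
    have "?L v \<le> ?L u" if v: "v \<in> rate_dom \<mu>" for v
    proof (cases "v \<in> range cgf1")
      case True
      then show ?thesis using \<theta> by (auto simp: L_cgf1)
    next
      case False
      then show ?thesis
        using better[OF v False] \<theta> by (metis L_cgf1 less_imp_le order_trans)
    qed
    then show "global_maximizer \<mu> H1 H2 \<beta>1 \<beta>2 u"
      using dom \<theta>(1) by (auto simp: global_maximizer_def)
  qed
qed

section \<open>Stationary points and maximizers\<close>

lemma legendre_has_derivative: "(legendre has_real_derivative \<theta> * cgf2 \<theta>) (at \<theta>)"
  unfolding legendre_def[abs_def]
  by (auto intro!: derivative_eq_intros cgf_has_derivative cgf1_has_derivative)

lemma tilted_L_has_derivative:
  "(tilted_L p \<beta>1 \<beta>2 has_real_derivative cgf2 \<theta> * stationarity p \<beta>1 \<beta>2 \<theta>) (at \<theta>)"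
  unfolding tilted_L_def[abs_def] stationarity_def
  by (auto intro!: derivative_eq_intros legendre_has_derivative cgf1_has_derivative
      simp: algebra_simps)

lemma continuous_tilted_L: "continuous_on A (tilted_L p \<beta>1 \<beta>2)"
  by (rule DERIV_continuous_on) (rule has_field_derivative_at_within[OF tilted_L_has_derivative])

lemma maximizer_stationary:
  assumes "tilted_maximizer p \<beta>1 \<beta>2 \<theta>"
  shows "stationarity p \<beta>1 \<beta>2 \<theta> = 0"
proof -
  have "cgf2 \<theta> * stationarity p \<beta>1 \<beta>2 \<theta> = 0"
    using DERIV_local_max[OF tilted_L_has_derivative, of 1] assms
    by (auto simp: tilted_maximizer_def)
  then show ?thesis using cgf2_pos[of \<theta>] by simp
qed

lemma tilted_L_increasing:
  assumes "a \<le> b" "\<And>t. a \<le> t \<Longrightarrow> t \<le> b \<Longrightarrow> 0 \<le> stationarity p \<beta>1 \<beta>2 t"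
  shows "tilted_L p \<beta>1 \<beta>2 a \<le> tilted_L p \<beta>1 \<beta>2 b"
  by (rule DERIV_nonneg_imp_nondecreasing[OF assms(1)], rule exI, rule conjI,
      rule tilted_L_has_derivative) (use assms(2) cgf2_pos in \<open>simp add: less_imp_le\<close>)

lemma tilted_L_decreasing:
  assumes "a \<le> b" "\<And>t. a \<le> t \<Longrightarrow> t \<le> b \<Longrightarrow> stationarity p \<beta>1 \<beta>2 t \<le> 0"
  shows "tilted_L p \<beta>1 \<beta>2 b \<le> tilted_L p \<beta>1 \<beta>2 a"
  by (rule DERIV_nonpos_imp_nonincreasing[OF assms(1)], rule exI, rule conjI,
      rule tilted_L_has_derivative) (use assms(2) cgf2_pos in \<open>simp add: mult_nonneg_nonpos less_imp_le\<close>)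

text \<open>The coefficient of \<open>\<beta>2\<close> in the objective is the increasing function \<open>u ^ p\<close>; adding the two
  optimality inequalities leaves only this term.\<close>

lemma maximizers_mono:
  assumes "\<beta>2 < \<beta>2'" "tilted_maximizer p \<beta>1 \<beta>2 \<theta>" "tilted_maximizer p \<beta>1 \<beta>2' \<theta>'" "0 < p"
  shows "\<theta> \<le> \<theta>'"
proof -
  let ?u = "cgf1 \<theta>" and ?v = "cgf1 \<theta>'"
  have "tilted_L p \<beta>1 \<beta>2 \<theta>' \<le> tilted_L p \<beta>1 \<beta>2 \<theta>" "tilted_L p \<beta>1 \<beta>2' \<theta> \<le> tilted_L p \<beta>1 \<beta>2' \<theta>'"
    using assms by (auto simp: tilted_maximizer_def)
  then have "(\<beta>2' - \<beta>2) * ?u ^ p \<le> (\<beta>2' - \<beta>2) * ?v ^ p"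
    by (simp add: tilted_L_def algebra_simps)
  then have "?u ^ p \<le> ?v ^ p"
    using assms(1) by simp
  then have "?u \<le> ?v"
    using assms(4) cgf1_pos[of \<theta>] cgf1_pos[of \<theta>'] by (simp add: power_mono_iff less_imp_le)
  then show ?thesis by (simp add: cgf1_le_iff)
qed

text \<open>The objective increases up to \<open>2 * \<beta>1\<close>, so the maximum may be sought on a compact interval.\<close>

lemma left_maximum_exists:
  assumes "0 \<le> \<beta>2"
  shows "\<exists>\<theta>\<le>c. \<forall>t\<le>c. tilted_L p \<beta>1 \<beta>2 t \<le> tilted_L p \<beta>1 \<beta>2 \<theta>"
proof -
  let ?a = "min c (2 * \<beta>1)"
  obtain \<theta> where \<theta>: "\<theta> \<in> {?a..c}" "\<And>t. t \<in> {?a..c} \<Longrightarrow> tilted_L p \<beta>1 \<beta>2 t \<le> tilted_L p \<beta>1 \<beta>2 \<theta>"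
    using continuous_attains_sup[OF compact_Icc _ continuous_tilted_L, of ?a c] by force
  have pos: "0 \<le> stationarity p \<beta>1 \<beta>2 t" if "t \<le> ?a" for t
  proof -
    have "0 \<le> real p * \<beta>2 * cgf1 t ^ (p - 1)"
      using assms cgf1_pos[of t] by simp
    then show ?thesis using that by (simp add: stationarity_def)
  qed
  have "tilted_L p \<beta>1 \<beta>2 t \<le> tilted_L p \<beta>1 \<beta>2 \<theta>" if "t \<le> c" for t
  proof (cases "t \<le> ?a")
    case True
    then have "tilted_L p \<beta>1 \<beta>2 t \<le> tilted_L p \<beta>1 \<beta>2 ?a"
      by (intro tilted_L_increasing pos) auto
    also have "\<dots> \<le> tilted_L p \<beta>1 \<beta>2 \<theta>" by (rule \<theta>(2)) simp
    finally show ?thesis .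
  qed (use \<theta>(2) that in simp)
  then show ?thesis using \<theta>(1) by auto
qed

text \<open>Since \<open>cgf1\<close> is below \<open>1\<close>, the objective decreases from \<open>2 * \<beta>1 + 2 * p * \<beta>2\<close> on.\<close>

lemma right_maximum_exists:
  assumes "0 \<le> \<beta>2"
  shows "\<exists>\<theta>\<ge>c. \<forall>t\<ge>c. tilted_L p \<beta>1 \<beta>2 t \<le> tilted_L p \<beta>1 \<beta>2 \<theta>"
proof -
  let ?b = "max c (2 * \<beta>1 + 2 * real p * \<beta>2)"
  obtain \<theta> where \<theta>: "\<theta> \<in> {c..?b}" "\<And>t. t \<in> {c..?b} \<Longrightarrow> tilted_L p \<beta>1 \<beta>2 t \<le> tilted_L p \<beta>1 \<beta>2 \<theta>"
    using continuous_attains_sup[OF compact_Icc _ continuous_tilted_L, of c ?b] by force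
  have neg: "stationarity p \<beta>1 \<beta>2 t \<le> 0" if "?b \<le> t" for t
  proof -
    have "cgf1 t ^ (p - 1) \<le> 1"
      using cgf1_pos[of t] cgf1_less_1[of t] by (simp add: power_le_one)
    then have "real p * \<beta>2 * cgf1 t ^ (p - 1) \<le> real p * \<beta>2"
      using assms by (simp add: mult_left_le)
    then show ?thesis using that by (simp add: stationarity_def)
  qed
  have "tilted_L p \<beta>1 \<beta>2 t \<le> tilted_L p \<beta>1 \<beta>2 \<theta>" if "c \<le> t" for t
  proof (cases "?b \<le> t")
    case True
    then have "tilted_L p \<beta>1 \<beta>2 t \<le> tilted_L p \<beta>1 \<beta>2 ?b"
      by (intro tilted_L_decreasing neg) auto
    also have "\<dots> \<le> tilted_L p \<beta>1 \<beta>2 \<theta>" by (rule \<theta>(2)) simp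
    finally show ?thesis .
  qed (use \<theta>(2) that in simp)
  then show ?thesis using \<theta>(1) by auto
qed

lemma tilted_L_Lipschitz: "\<bar>tilted_L p \<beta>1 \<beta>2 \<theta> - tilted_L p \<beta>1 \<beta>2' \<theta>\<bar> \<le> \<bar>\<beta>2 - \<beta>2'\<bar>"
proof -
  have "tilted_L p \<beta>1 \<beta>2 \<theta> - tilted_L p \<beta>1 \<beta>2' \<theta> = (\<beta>2 - \<beta>2') * cgf1 \<theta> ^ p"
    by (simp add: tilted_L_def algebra_simps)
  moreover have "0 \<le> cgf1 \<theta> ^ p" "cgf1 \<theta> ^ p \<le> 1"
    using cgf1_pos[of \<theta>] cgf1_less_1[of \<theta>] by (simp_all add: power_le_one)
  ultimately show ?thesis by (simp add: abs_mult mult_left_le)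
qed

end

section \<open>The S-shaped curve\<close>

locale edge_weight_model = symmetric_unit_distribution +
  fixes p :: nat
  assumes p_ge_2: "2 \<le> p" and critical_unique: "\<exists>!\<theta>. critical_eq \<mu> p \<theta>"
begin

abbreviation \<theta>\<^sub>0 :: real where "\<theta>\<^sub>0 \<equiv> theta0 \<mu> p"

definition critical_expr :: "real \<Rightarrow> real" where
  "critical_expr \<theta> = cgf3 \<theta> * cgf1 \<theta> + (real p - 2) * (cgf2 \<theta>)\<^sup>2"

text \<open>The derivative of \<open>cgf1 \<theta> ^ (p - 1)\<close> up to the constant factor \<open>p - 1\<close>.\<close>

definition slope :: "real \<Rightarrow> real" where
  "slope \<theta> = cgf1 \<theta> ^ (p - 2) * cgf2 \<theta>"

lemma critical_expr_eq_0_iff: "critical_expr \<theta> = 0 \<longleftrightarrow> \<theta> = \<theta>\<^sub>0"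
proof -
  have "critical_eq \<mu> p \<theta> \<longleftrightarrow> critical_expr \<theta> = 0"
    by (auto simp: critical_eq_def critical_expr_def deriv_cgf algebra_simps)
  moreover have "critical_eq \<mu> p \<theta> \<longleftrightarrow> \<theta> = \<theta>\<^sub>0"
    using theI'[OF critical_unique] critical_unique by (auto simp: theta0_def)
  ultimately show ?thesis by simp
qed

lemma slope_pos: "0 < slope \<theta>"
  using cgf1_pos[of \<theta>] cgf2_pos[of \<theta>] by (simp add: slope_def)

lemma power_cgf1_has_derivative:
  "((\<lambda>\<theta>. cgf1 \<theta> ^ (p - 1)) has_real_derivative (real p - 1) * slope \<theta>) (at \<theta>)"
proof -
  have "p - 1 - Suc 0 = p - 2" "real (p - 1) = real p - 1"
    using p_ge_2 by (simp_all add: of_nat_diff)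
  then show ?thesis
    unfolding slope_def
    by (auto intro!: derivative_eq_intros cgf1_has_derivative simp: algebra_simps)
qed

lemma slope_has_derivative:
  "(slope has_real_derivative cgf1 \<theta> ^ (p - 2) / cgf1 \<theta> * critical_expr \<theta>) (at \<theta>)"
proof -
  have c: "cgf1 \<theta> \<noteq> 0" using cgf1_pos[of \<theta>] by simp
  have "real (p - 2) * cgf1 \<theta> ^ (p - 2 - 1) = (real p - 2) * cgf1 \<theta> ^ (p - 2) / cgf1 \<theta>"
  proof (cases "p - 2")
    case 0
    then have "p = 2" using p_ge_2 by simp
    then show ?thesis by simp
  next
    case (Suc n)
    then have "real p - 2 = real (Suc n)" using p_ge_2 by (simp add: of_nat_diff)
    then show ?thesis using c Suc by simp
  qed
  moreover have "(slope has_real_derivative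
      (real (p - 2) * cgf1 \<theta> ^ (p - 2 - 1)) * cgf2 \<theta> * cgf2 \<theta> + cgf1 \<theta> ^ (p - 2) * cgf3 \<theta>) (at \<theta>)"
    unfolding slope_def[abs_def]
    by (auto intro!: derivative_eq_intros cgf1_has_derivative cgf2_has_derivative)
  moreover have "(real p - 2) * cgf1 \<theta> ^ (p - 2) / cgf1 \<theta> * cgf2 \<theta> * cgf2 \<theta> + cgf1 \<theta> ^ (p - 2) * cgf3 \<theta>
      = cgf1 \<theta> ^ (p - 2) / cgf1 \<theta> * critical_expr \<theta>"
    using c by (simp add: critical_expr_def power2_eq_square field_simps)
  ultimately show ?thesis by simp
qed

lemma continuous_slope: "continuous_on A slope"
  by (rule DERIV_continuous_on) (rule has_field_derivative_at_within[OF slope_has_derivative])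

lemma continuous_critical_expr: "continuous_on A critical_expr"
proof -
  have "continuous_on UNIV cgf1" "continuous_on UNIV cgf2"
    by (rule DERIV_continuous_on, rule cgf1_has_derivative cgf2_has_derivative)+
  then have "continuous_on UNIV critical_expr"
    unfolding critical_expr_def[abs_def] by (intro continuous_intros continuous_cgf3)
  then show ?thesis by (rule continuous_on_subset) simp
qed

lemma slope_mono:
  assumes "a \<le> b" "\<And>t. a \<le> t \<Longrightarrow> t \<le> b \<Longrightarrow> 0 \<le> critical_expr t"
  shows "slope a \<le> slope b"
  by (rule DERIV_nonneg_imp_nondecreasing[OF assms(1)], rule exI, rule conjI,
      rule slope_has_derivative) (use assms(2) cgf1_pos in \<open>simp add: less_imp_le\<close>)

lemma slope_antimono:
  assumes "a \<le> b" "\<And>t. a \<le> t \<Longrightarrow> t \<le> b \<Longrightarrow> critical_expr t \<le> 0"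
  shows "slope b \<le> slope a"
  by (rule DERIV_nonpos_imp_nonincreasing[OF assms(1)], rule exI, rule conjI,
      rule slope_has_derivative)
     (use assms(2) cgf1_pos in \<open>simp add: less_imp_le divide_nonpos_pos mult_nonneg_nonpos\<close>)

text \<open>The power \<open>cgf1 \<theta> ^ (p - 1)\<close> increases by less than \<open>1\<close> in total. Hence the slope cannot
  stay above a positive constant on long intervals.\<close>

lemma slope_not_bounded_below:
  assumes "0 < c" "0 < d" "\<And>t. a \<le> t \<Longrightarrow> t \<le> a + d \<Longrightarrow> c \<le> slope t"
  shows "d * c < 1"
proof -
  have "a < a + d" using assms(2) by simp
  from MVT2[OF this power_cgf1_has_derivative]
  obtain z where z: "a < z" "z < a + d"
    "cgf1 (a + d) ^ (p - 1) - cgf1 a ^ (p - 1) = d * ((real p - 1) * slope z)"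
    by auto
  have "cgf1 (a + d) ^ (p - 1) < 1" "0 < cgf1 a ^ (p - 1)"
    using cgf1_pos cgf1_less_1 p_ge_2 by (simp_all add: power_less_one_iff less_imp_le)
  moreover have "c \<le> (real p - 1) * slope z"
    using assms(3)[of z] z p_ge_2 slope_pos[of z] mult_right_mono[of 1 "real p - 1" "slope z"]
    by linarith
  then have "d * c \<le> d * ((real p - 1) * slope z)"
    using assms(2) by simp
  ultimately show ?thesis using z(3) by linarith
qed

text \<open>The critical expression has constant sign left of its only zero. A negative sign would make
  the slope decreasing there, hence bounded away from \<open>0\<close> on a half-line, which is impossible for
  a bounded curve.\<close>

lemma critical_expr_pos:
  assumes "t < \<theta>\<^sub>0"
  shows "0 < critical_expr t"
proof (rule ccontr)
  assume "\<not> 0 < critical_expr t"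
  then have neg: "critical_expr t < 0"
    using critical_expr_eq_0_iff[of t] assms by linarith
  have below: "critical_expr x \<le> 0" if le: "x \<le> t" for x
  proof (rule ccontr)
    assume "\<not> critical_expr x \<le> 0"
    then obtain z where "x \<le> z" "z \<le> t" "critical_expr z = 0"
      using IVT2'[of critical_expr t 0 x] neg le continuous_critical_expr[of "{x..t}"] by auto
    then show False using critical_expr_eq_0_iff assms by auto
  qed
  let ?d = "1 / slope t"
  have "?d * slope t < 1"
  proof (rule slope_not_bounded_below[where a = "t - ?d"])
    show "slope t \<le> slope s" if "t - ?d \<le> s" "s \<le> t - ?d + ?d" for s
      using that by (intro slope_antimono below) auto
  qed (use slope_pos[of t] in auto)
  then show False using slope_pos[of t] by simp
qed

text \<open>The mirror image of the preceding argument: a positive sign would make the slope increasing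
  on a right half-line.\<close>

lemma critical_expr_neg:
  assumes "\<theta>\<^sub>0 < t"
  shows "critical_expr t < 0"
proof (rule ccontr)
  assume "\<not> critical_expr t < 0"
  then have pos: "0 < critical_expr t"
    using critical_expr_eq_0_iff[of t] assms by linarith
  have above: "0 \<le> critical_expr x" if le: "t \<le> x" for x
  proof (rule ccontr)
    assume "\<not> 0 \<le> critical_expr x"
    then obtain z where "t \<le> z" "z \<le> x" "critical_expr z = 0"
      using IVT2'[of critical_expr x 0 t] pos le continuous_critical_expr[of "{t..x}"] by auto
    then show False using critical_expr_eq_0_iff assms by auto
  qed
  let ?d = "1 / slope t"
  have "?d * slope t < 1"
  proof (rule slope_not_bounded_below[where a = t])
    show "slope t \<le> slope s" if "t \<le> s" "s \<le> t + ?d" for s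
      using that by (intro slope_mono above) auto
  qed (use slope_pos[of t] in auto)
  then show False using slope_pos[of t] by simp
qed

lemma slope_strict_mono:
  assumes "x < y" "y \<le> \<theta>\<^sub>0"
  shows "slope x < slope y"
proof (rule DERIV_pos_imp_increasing_open[OF assms(1) _ continuous_slope])
  show "\<exists>D. (slope has_real_derivative D) (at t) \<and> 0 < D" if "x < t" "t < y" for t
    by (rule exI, rule conjI, rule slope_has_derivative)
       (use critical_expr_pos[of t] cgf1_pos[of t] that assms(2) in simp)
qed

lemma slope_strict_antimono:
  assumes "x < y" "\<theta>\<^sub>0 \<le> x"
  shows "slope y < slope x"
proof (rule DERIV_neg_imp_decreasing_open[OF assms(1) _ continuous_slope])
  show "\<exists>D. (slope has_real_derivative D) (at t) \<and> D < 0" if "x < t" "t < y" for t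
    by (rule exI, rule conjI, rule slope_has_derivative)
       (use critical_expr_neg[of t] cgf1_pos[of t] that assms(2) in
         \<open>simp add: mult_pos_neg divide_neg_pos\<close>)
qed

section \<open>Existence and uniqueness of the transition\<close>

abbreviation objective :: "real \<Rightarrow> real \<Rightarrow> real \<Rightarrow> real" where
  "objective \<equiv> tilted_L p"

abbreviation maximizer :: "real \<Rightarrow> real \<Rightarrow> real \<Rightarrow> bool" where
  "maximizer \<equiv> tilted_maximizer p"

lemma stationarity_has_derivative:
  "(stationarity p \<beta>1 \<beta>2 has_real_derivative real p * (real p - 1) * \<beta>2 * slope \<theta> - 1 / 2) (at \<theta>)"
proof -
  have "((\<lambda>\<theta>. \<beta>1 + real p * \<beta>2 * cgf1 \<theta> ^ (p - 1) - \<theta> / 2) has_real_derivative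
      0 + real p * \<beta>2 * ((real p - 1) * slope \<theta>) - 1 / 2) (at \<theta>)"
    by (intro DERIV_diff DERIV_add DERIV_const DERIV_cmult DERIV_cdivide DERIV_ident
        power_cgf1_has_derivative)
  then show ?thesis
    unfolding stationarity_def[abs_def] by (simp add: mult_ac)
qed

text \<open>Rolle's theorem for the objective gives a third stationary point between the two maximizers.
  Rolle's theorem for \<open>stationarity\<close> on either side of it gives two points where the slope takes
  the same value, and these lie on opposite sides of its peak \<open>\<theta>\<^sub>0\<close>.\<close>

lemma maximizers_straddle:
  assumes "maximizer \<beta>1 \<beta>2 a" "maximizer \<beta>1 \<beta>2 b" "a < b"
  shows "a < \<theta>\<^sub>0" "\<theta>\<^sub>0 < b" "\<beta>2 \<noteq> 0"
proof -
  have Rolle: "\<exists>z. x < z \<and> z < y \<and> f' z = 0"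
    if "x < y" "f x = f y" "\<And>t. (f has_real_derivative f' t) (at t)" for x y :: real and f f'
    using MVT2[of x y f f'] that by auto
  have "objective \<beta>1 \<beta>2 a = objective \<beta>1 \<beta>2 b"
    using assms by (intro antisym) (auto simp: tilted_maximizer_def)
  then obtain z where z: "a < z" "z < b" "cgf2 z * stationarity p \<beta>1 \<beta>2 z = 0"
    using Rolle[OF assms(3) _ tilted_L_has_derivative] by blast
  then have stat: "stationarity p \<beta>1 \<beta>2 z = 0" "stationarity p \<beta>1 \<beta>2 a = 0" "stationarity p \<beta>1 \<beta>2 b = 0"
    using cgf2_pos[of z] maximizer_stationary assms by auto
  obtain x y where xy: "a < x" "x < z" "z < y" "y < b"
    and x: "real p * (real p - 1) * \<beta>2 * slope x = 1 / 2"
    and y: "real p * (real p - 1) * \<beta>2 * slope y = 1 / 2"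
    using Rolle[OF z(1) _ stationarity_has_derivative] Rolle[OF z(2) _ stationarity_has_derivative] stat
    by (metis eq_iff_diff_eq_0)
  show b2: "\<beta>2 \<noteq> 0" using x by auto
  have "real p * (real p - 1) * \<beta>2 * slope x = real p * (real p - 1) * \<beta>2 * slope y"
    using x y by (rule trans[OF _ sym])
  then have eq: "slope x = slope y" using b2 p_ge_2 by simp
  have "x < \<theta>\<^sub>0" using slope_strict_antimono[of x y] eq xy by force
  then show "a < \<theta>\<^sub>0" using xy by simp
  have "\<theta>\<^sub>0 < y" using slope_strict_mono[of x y] eq xy by force
  then show "\<theta>\<^sub>0 < b" using xy by simp
qed

lemma beta1_crit_eq: "beta1_crit \<mu> p = \<theta>\<^sub>0 / 2 - cgf1 \<theta>\<^sub>0 / (2 * (real p - 1) * cgf2 \<theta>\<^sub>0)"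
  by (simp add: beta1_crit_def deriv_cgf)

lemma beta2_crit_eq: "beta2_crit \<mu> p = 1 / (2 * real p * (real p - 1) * slope \<theta>\<^sub>0)"
  by (simp add: beta2_crit_def deriv_cgf slope_def mult_ac)

lemma power_cgf1_eq: "cgf1 \<theta> ^ (p - 1) * cgf2 \<theta> = cgf1 \<theta> * slope \<theta>"
proof -
  have "p - 1 = Suc (p - 2)" using p_ge_2 by simp
  then show ?thesis by (simp add: slope_def)
qed

text \<open>Below the critical value of \<open>\<beta>1\<close>, stationarity at \<open>\<theta>\<^sub>0\<close> forces \<open>\<beta>2\<close> to be so large that
  \<open>stationarity\<close> is increasing there, and \<open>\<theta>\<^sub>0\<close> is a strict local minimum.\<close>

lemma theta0_not_maximizer:
  assumes "\<beta>1 < beta1_crit \<mu> p"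
  shows "\<not> maximizer \<beta>1 \<beta>2 \<theta>\<^sub>0"
proof
  assume max: "maximizer \<beta>1 \<beta>2 \<theta>\<^sub>0"
  let ?m = "stationarity p \<beta>1 \<beta>2"
  have m0: "?m \<theta>\<^sub>0 = 0" using maximizer_stationary[OF max] .
  have K: "0 < cgf2 \<theta>\<^sub>0" "0 < cgf1 \<theta>\<^sub>0" "0 < real p - 1"
    using cgf1_pos cgf2_pos p_ge_2 by auto
  have "cgf1 \<theta>\<^sub>0 / (2 * (real p - 1) * cgf2 \<theta>\<^sub>0) < \<theta>\<^sub>0 / 2 - \<beta>1"
    using assms by (simp add: beta1_crit_eq)
  also have "\<dots> = real p * \<beta>2 * cgf1 \<theta>\<^sub>0 ^ (p - 1)"
    using m0 by (simp add: stationarity_def)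
  finally have "cgf1 \<theta>\<^sub>0 < real p * \<beta>2 * cgf1 \<theta>\<^sub>0 ^ (p - 1) * (2 * (real p - 1) * cgf2 \<theta>\<^sub>0)"
    using K by (simp add: pos_divide_less_eq)
  also have "\<dots> = cgf1 \<theta>\<^sub>0 * (2 * (real p * (real p - 1) * \<beta>2 * slope \<theta>\<^sub>0))"
    using power_cgf1_eq[of \<theta>\<^sub>0] by (simp add: algebra_simps)
  finally have "0 < real p * (real p - 1) * \<beta>2 * slope \<theta>\<^sub>0 - 1 / 2"
    using K by (simp add: mult_less_cancel_left1)
  from DERIV_pos_inc_right[OF stationarity_has_derivative[of \<beta>1] this]
  obtain d where d: "0 < d" "\<And>h. 0 < h \<Longrightarrow> h < d \<Longrightarrow> 0 < ?m (\<theta>\<^sub>0 + h)"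
    using m0 by auto
  have "objective \<beta>1 \<beta>2 \<theta>\<^sub>0 < objective \<beta>1 \<beta>2 (\<theta>\<^sub>0 + d / 2)"
  proof (rule DERIV_pos_imp_increasing_open[OF _ _ continuous_tilted_L])
    fix t assume "\<theta>\<^sub>0 < t" "t < \<theta>\<^sub>0 + d / 2"
    then have "0 < cgf2 t * ?m t" using d(2)[of "t - \<theta>\<^sub>0"] cgf2_pos[of t] by simp
    then show "\<exists>D. (objective \<beta>1 \<beta>2 has_real_derivative D) (at t) \<and> 0 < D"
      using tilted_L_has_derivative by blast
  qed (use d in simp)
  then show False using max by (auto simp: tilted_maximizer_def not_le[symmetric])
qed

definition two_maximizers :: "real \<Rightarrow> real \<Rightarrow> bool" where
  "two_maximizers \<beta>1 \<beta>2 \<longleftrightarrow> 0 \<le> \<beta>2 \<and> (\<exists>a b. a < b \<and> maximizer \<beta>1 \<beta>2 a \<and> maximizer \<beta>1 \<beta>2 b)"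

text \<open>For the smaller \<open>\<beta>2\<close> some maximizer exceeds \<open>\<theta>\<^sub>0\<close>, for the larger one some maximizer is
  below \<open>\<theta>\<^sub>0\<close>; this contradicts the monotonicity of maximizers in \<open>\<beta>2\<close>.\<close>

lemma two_maximizers_unique:
  assumes "two_maximizers \<beta>1 \<beta>2" "two_maximizers \<beta>1 \<beta>2'"
  shows "\<beta>2 = \<beta>2'"
proof -
  have False if two: "two_maximizers \<beta>1 s" "two_maximizers \<beta>1 t" and st: "s < t" for s t
  proof -
    obtain a b where ab: "a < b" "maximizer \<beta>1 s a" "maximizer \<beta>1 s b"
      using two(1) by (auto simp: two_maximizers_def)
    obtain c d where cd: "c < d" "maximizer \<beta>1 t c" "maximizer \<beta>1 t d"
      using two(2) by (auto simp: two_maximizers_def)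
    have "\<theta>\<^sub>0 < b" "c < \<theta>\<^sub>0"
      using maximizers_straddle[OF ab(2,3,1)] maximizers_straddle[OF cd(2,3,1)] by auto
    moreover have "b \<le> c" using maximizers_mono[OF st ab(3) cd(2)] p_ge_2 by simp
    ultimately show False by simp
  qed
  from this[of \<beta>2 \<beta>2'] this[of \<beta>2' \<beta>2] show ?thesis using assms by force
qed

text \<open>The intermediate value theorem is applied to the difference between the maxima over the two
  half-lines separated by \<open>\<theta>\<^sub>0\<close>, as a function of \<open>\<beta>2\<close>.\<close>

lemma two_maximizers_exist:
  assumes b1: "\<beta>1 < beta1_crit \<mu> p"
  shows "\<exists>\<beta>2. two_maximizers \<beta>1 \<beta>2"
proof -
  \<comment> \<open>Maximizers on the left and on the right half-line, chosen for each \<open>\<beta>2\<close>.\<close>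
  define l where "l \<beta>2 = (SOME \<theta>. \<theta> \<le> \<theta>\<^sub>0 \<and> (\<forall>t\<le>\<theta>\<^sub>0. objective \<beta>1 \<beta>2 t \<le> objective \<beta>1 \<beta>2 \<theta>))" for \<beta>2
  define r where "r \<beta>2 = (SOME \<theta>. \<theta> \<ge> \<theta>\<^sub>0 \<and> (\<forall>t\<ge>\<theta>\<^sub>0. objective \<beta>1 \<beta>2 t \<le> objective \<beta>1 \<beta>2 \<theta>))" for \<beta>2
  have l: "l \<beta>2 \<le> \<theta>\<^sub>0" "\<And>t. t \<le> \<theta>\<^sub>0 \<Longrightarrow> objective \<beta>1 \<beta>2 t \<le> objective \<beta>1 \<beta>2 (l \<beta>2)" if "0 \<le> \<beta>2" for \<beta>2
    using someI_ex[OF left_maximum_exists[OF that, of \<theta>\<^sub>0 p \<beta>1, unfolded Bex_def]] by (auto simp: l_def)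
  have r: "\<theta>\<^sub>0 \<le> r \<beta>2" "\<And>t. \<theta>\<^sub>0 \<le> t \<Longrightarrow> objective \<beta>1 \<beta>2 t \<le> objective \<beta>1 \<beta>2 (r \<beta>2)" if "0 \<le> \<beta>2" for \<beta>2
    using someI_ex[OF right_maximum_exists[OF that, of \<theta>\<^sub>0 p \<beta>1, unfolded Bex_def]] by (auto simp: r_def)
  define F where "F \<beta>2 = objective \<beta>1 \<beta>2 (r \<beta>2) - objective \<beta>1 \<beta>2 (l \<beta>2)" for \<beta>2
  \<comment> \<open>A maximum of 1-Lipschitz functions is 1-Lipschitz, so \<open>F\<close> is 2-Lipschitz.\<close>
  have lip: "F s - F t \<le> 2 * \<bar>s - t\<bar>" if "0 \<le> s" "0 \<le> t" for s t
  proof -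
    have "objective \<beta>1 s (r s) - objective \<beta>1 t (r t) \<le> objective \<beta>1 s (r s) - objective \<beta>1 t (r s)"
      using r[OF that(2)] r(1)[OF that(1)] by simp
    moreover have "objective \<beta>1 t (l t) - objective \<beta>1 s (l s) \<le> objective \<beta>1 t (l t) - objective \<beta>1 s (l t)"
      using l[OF that(1)] l(1)[OF that(2)] by simp
    ultimately show ?thesis
      using tilted_L_Lipschitz[of p \<beta>1 s "r s" t] tilted_L_Lipschitz[of p \<beta>1 t "l t" s]
      by (simp add: F_def abs_if split: if_splits)
  qed
  have cont: "continuous_on {0..B} F" for B
  proof (rule continuous_onI)
    fix x and e :: real assume "x \<in> {0..B}" "0 < e"
    moreover have "dist (F y) (F x) \<le> e" if "y \<in> {0..B}" "dist y x < e / 2" for y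
      using lip[of x y] lip[of y x] that \<open>x \<in> {0..B}\<close> by (simp add: dist_real_def abs_le_iff abs_minus_commute)
    ultimately show "\<exists>d>0. \<forall>y\<in>{0..B}. dist y x < d \<longrightarrow> dist (F y) (F x) \<le> e"
      by (intro exI[of _ "e / 2"]) auto
  qed
  \<comment> \<open>With \<open>\<beta>2 = 0\<close> the objective decreases right of \<open>2 * \<beta>1\<close>, which lies left of \<open>\<theta>\<^sub>0\<close>.\<close>
  have F0: "F 0 \<le> 0"
  proof -
    have "0 < cgf1 \<theta>\<^sub>0 / (2 * (real p - 1) * cgf2 \<theta>\<^sub>0)"
      using cgf1_pos cgf2_pos p_ge_2 by simp
    then have "2 * \<beta>1 \<le> \<theta>\<^sub>0"
      using b1 by (simp add: beta1_crit_eq)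
    then have "objective \<beta>1 0 (r 0) \<le> objective \<beta>1 0 \<theta>\<^sub>0"
      using r(1)[of 0] by (intro tilted_L_decreasing) (auto simp: stationarity_def)
    also have "\<dots> \<le> objective \<beta>1 0 (l 0)" using l(2)[of 0 "\<theta>\<^sub>0"] by simp
    finally show ?thesis by (simp add: F_def)
  qed
  \<comment> \<open>At \<open>?B\<close> the gain in \<open>u ^ p\<close> between \<open>\<theta>\<^sub>0\<close> and \<open>\<theta>\<^sub>0 + 1\<close> outweighs the other terms.\<close>
  let ?u = "cgf1 (\<theta>\<^sub>0 + 1)" and ?v = "cgf1 \<theta>\<^sub>0"
  let ?B = "(2 * \<bar>\<beta>1\<bar> + legendre (\<theta>\<^sub>0 + 1)) / (?u ^ p - ?v ^ p)"
  have gap: "0 < ?u ^ p - ?v ^ p"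
    using cgf1_strict_mono[of \<theta>\<^sub>0 "\<theta>\<^sub>0 + 1"] cgf1_pos[of \<theta>\<^sub>0] p_ge_2 by (simp add: power_strict_mono)
  have B: "0 \<le> ?B" using gap legendre_nonneg[of "\<theta>\<^sub>0 + 1"] by simp
  have FB: "0 \<le> F ?B"
  proof -
    have unit: "\<bar>\<beta>1 * cgf1 t\<bar> \<le> \<bar>\<beta>1\<bar>" for t
      using cgf1_pos[of t] cgf1_less_1[of t] by (simp add: abs_mult mult_left_le)
    have "cgf1 (l ?B) ^ p \<le> ?v ^ p"
      using l(1)[OF B] cgf1_pos[of "l ?B"] by (intro power_mono) (auto simp: cgf1_le_iff)
    then have "?B * cgf1 (l ?B) ^ p \<le> ?B * ?v ^ p"
      using B by (rule mult_left_mono)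
    then have "objective \<beta>1 ?B (l ?B) \<le> \<bar>\<beta>1\<bar> + ?B * ?v ^ p"
      using unit[of "l ?B"] legendre_nonneg[of "l ?B"] unfolding tilted_L_def abs_le_iff by linarith
    also have "?B * ?v ^ p = ?B * ?u ^ p - (2 * \<bar>\<beta>1\<bar> + legendre (\<theta>\<^sub>0 + 1))"
    proof -
      have "?B * (?u ^ p - ?v ^ p) = 2 * \<bar>\<beta>1\<bar> + legendre (\<theta>\<^sub>0 + 1)" using gap by simp
      then show ?thesis unfolding right_diff_distrib by linarith
    qed
    also have "\<bar>\<beta>1\<bar> + \<dots> \<le> objective \<beta>1 ?B (\<theta>\<^sub>0 + 1)"
      using unit[of "\<theta>\<^sub>0 + 1"] legendre_nonneg[of "\<theta>\<^sub>0 + 1"] unfolding tilted_L_def abs_le_iff by linarith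
    also have "\<dots> \<le> objective \<beta>1 ?B (r ?B)" using r(2)[OF B] by simp
    finally show ?thesis by (simp add: F_def)
  qed
  obtain \<beta>2 where \<beta>2: "0 \<le> \<beta>2" "F \<beta>2 = 0"
    using IVT'[of F 0 0 ?B, OF F0 FB B cont] by auto
  have eq: "objective \<beta>1 \<beta>2 (r \<beta>2) = objective \<beta>1 \<beta>2 (l \<beta>2)"
    using \<beta>2(2) by (simp add: F_def)
  have max: "maximizer \<beta>1 \<beta>2 (l \<beta>2)" "maximizer \<beta>1 \<beta>2 (r \<beta>2)"
    using l(2)[OF \<beta>2(1)] r(2)[OF \<beta>2(1)] eq unfolding tilted_maximizer_def by (metis linear)+
  then have "l \<beta>2 \<noteq> \<theta>\<^sub>0" using theta0_not_maximizer[OF b1] by auto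
  then have "l \<beta>2 < r \<beta>2" using l(1)[OF \<beta>2(1)] r(1)[OF \<beta>2(1)] by simp
  then show ?thesis using max \<beta>2(1) by (auto simp: two_maximizers_def)
qed

lemma transition_r_eq:
  assumes H: "single_edge H1" "num_edges H2 = p" and two: "two_maximizers \<beta>1 \<beta>2"
    and b1: "\<beta>1 < beta1_crit \<mu> p"
  shows "transition_r \<mu> H1 H2 \<beta>1 = \<beta>2"
proof -
  have iff: "0 \<le> s \<and> (\<exists>u v. u \<noteq> v \<and> global_maximizer \<mu> H1 H2 \<beta>1 s u \<and> global_maximizer \<mu> H1 H2 \<beta>1 s v)
      \<longleftrightarrow> two_maximizers \<beta>1 s" for s
  proof (cases "0 \<le> s")
    case True
    have "(\<exists>u v. u \<noteq> v \<and> global_maximizer \<mu> H1 H2 \<beta>1 s u \<and> global_maximizer \<mu> H1 H2 \<beta>1 s v)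
        \<longleftrightarrow> (\<exists>a b. a \<noteq> b \<and> maximizer \<beta>1 s a \<and> maximizer \<beta>1 s b)"
      unfolding global_maximizer_iff[OF H True] using cgf1_inject by blast
    also have "\<dots> \<longleftrightarrow> (\<exists>a b. a < b \<and> maximizer \<beta>1 s a \<and> maximizer \<beta>1 s b)"
      unfolding neq_iff by blast
    finally show ?thesis using True by (simp add: two_maximizers_def)
  qed (simp add: two_maximizers_def)
  show ?thesis
    unfolding transition_r_def H(2) iff using b1 two two_maximizers_unique
    by (auto intro!: the_equality)
qed

lemma maximizer_exists:
  assumes "0 \<le> \<beta>2"
  shows "\<exists>\<theta>. maximizer \<beta>1 \<beta>2 \<theta>"
proof -
  obtain a b where a: "\<And>t. t \<le> 0 \<Longrightarrow> objective \<beta>1 \<beta>2 t \<le> objective \<beta>1 \<beta>2 a"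
    and b: "\<And>t. 0 \<le> t \<Longrightarrow> objective \<beta>1 \<beta>2 t \<le> objective \<beta>1 \<beta>2 b"
    using left_maximum_exists[OF assms, of 0 p \<beta>1] right_maximum_exists[OF assms, of 0 p \<beta>1] by metis
  show ?thesis unfolding tilted_maximizer_def by (metis a b linear order_trans)
qed

section \<open>The quadratic case\<close>

lemma theta0_eq_0:
  assumes "p = 2"
  shows "\<theta>\<^sub>0 = 0"
proof -
  have "critical_expr 0 = 0" unfolding critical_expr_def using assms by (simp add: cgf3_0)
  then show ?thesis using critical_expr_eq_0_iff[of 0] by simp
qed

lemma beta_crit_quadratic:
  assumes "p = 2"
  shows "beta1_crit \<mu> p = - 1 / (4 * cgf2 0)" "beta2_crit \<mu> p = 1 / (4 * cgf2 0)"
  unfolding beta1_crit_eq beta2_crit_eq theta0_eq_0[OF assms] slope_def using assms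
  by (simp_all add: cgf1_0)

text \<open>On the line \<open>\<beta>2 = - \<beta>1\<close> the objective is even in \<open>\<theta>\<close>, and the centre \<open>0 = \<theta>\<^sub>0\<close> is not a
  maximizer.\<close>

lemma two_maximizers_quadratic:
  assumes p: "p = 2" and b1: "\<beta>1 < beta1_crit \<mu> p"
  shows "two_maximizers \<beta>1 (- \<beta>1)"
proof -
  have refl: "objective \<beta>1 (- \<beta>1) (- t) = objective \<beta>1 (- \<beta>1) t" for t
    unfolding tilted_L_def legendre_reflect cgf1_reflect p by (simp add: power2_eq_square algebra_simps)
  have "\<beta>1 < 0"
    using b1 cgf2_pos[of 0] by (simp add: beta_crit_quadratic[OF p] divide_neg_pos order_less_trans)
  then obtain \<theta> where max: "maximizer \<beta>1 (- \<beta>1) \<theta>"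
    using maximizer_exists[of "- \<beta>1" \<beta>1] by auto
  then have max': "maximizer \<beta>1 (- \<beta>1) (- \<theta>)"
    by (simp add: tilted_maximizer_def refl)
  have "\<theta> \<noteq> 0" using max theta0_not_maximizer[OF b1] theta0_eq_0[OF p] by auto
  then have "\<theta> < - \<theta> \<or> - \<theta> < \<theta>" by linarith
  then have "\<exists>a b. a < b \<and> maximizer \<beta>1 (- \<beta>1) a \<and> maximizer \<beta>1 (- \<beta>1) b"
    using max max' by blast
  then show ?thesis
    using \<open>\<beta>1 < 0\<close> by (simp add: two_maximizers_def)
qed

section \<open>Exponents of at least three\<close>

text \<open>By symmetry the third cumulant vanishes at \<open>0\<close>, so the slope is still increasing there.\<close>

lemma theta0_pos:
  assumes "3 \<le> p"
  shows "0 < \<theta>\<^sub>0"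
proof (rule ccontr)
  assume "\<not> 0 < \<theta>\<^sub>0"
  then have "critical_expr 0 \<le> 0"
    using critical_expr_neg[of 0] critical_expr_eq_0_iff[of 0] by force
  moreover have "0 < critical_expr 0"
    using assms cgf2_pos[of 0] by (simp add: critical_expr_def cgf3_0)
  ultimately show False by simp
qed

text \<open>Reflecting a point right of \<open>1 / 2\<close> leaves the rate unchanged and, on or below the line
  \<open>\<beta>2 = - \<beta>1\<close>, strictly increases the polynomial part.\<close>

lemma maximizer_nonpos:
  assumes p: "3 \<le> p" and b2: "0 < \<beta>2" "\<beta>2 \<le> - \<beta>1" and max: "maximizer \<beta>1 \<beta>2 \<theta>"
  shows "\<theta> \<le> 0"
proof (rule ccontr)
  assume "\<not> \<theta> \<le> 0"
  then have u: "1 / 2 < cgf1 \<theta>"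
    using cgf1_strict_mono[of 0 \<theta>] by (simp add: cgf1_0)
  have "\<beta>2 * (cgf1 \<theta> ^ p - (1 - cgf1 \<theta>) ^ p) < \<beta>2 * (2 * cgf1 \<theta> - 1)"
    using b2 p u cgf1_less_1 by (intro mult_strict_left_mono power_antisymmetric_less) auto
  also have "\<dots> \<le> - \<beta>1 * (2 * cgf1 \<theta> - 1)"
    using b2 u by (intro mult_right_mono) auto
  finally have "objective \<beta>1 \<beta>2 \<theta> < objective \<beta>1 \<beta>2 (- \<theta>)"
    by (simp add: tilted_L_def legendre_reflect cgf1_reflect algebra_simps)
  then show False using max by (auto simp: tilted_maximizer_def not_le[symmetric])
qed

lemma two_maximizers_above_line:
  assumes p: "3 \<le> p" and two: "two_maximizers \<beta>1 \<beta>2"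
  shows "- \<beta>1 < \<beta>2"
proof (rule ccontr)
  assume le: "\<not> - \<beta>1 < \<beta>2"
  obtain a b where ab: "a < b" "maximizer \<beta>1 \<beta>2 a" "maximizer \<beta>1 \<beta>2 b"
    using two by (auto simp: two_maximizers_def)
  note straddle = maximizers_straddle[OF ab(2,3,1)]
  have "0 < \<beta>2" using two straddle(3) by (simp add: two_maximizers_def)
  then have "b \<le> 0" using le maximizer_nonpos[OF p _ _ ab(3)] by simp
  then show False using straddle(2) theta0_pos[OF p] by simp
qed

text \<open>Multiplied by \<open>2 * (p - 1) * slope \<theta>\<^sub>0\<close>, the claim says that the tangent to
  \<open>cgf1 \<theta> ^ (p - 1)\<close> at \<open>\<theta>\<^sub>0\<close> takes a value below \<open>1 / p\<close> at \<open>0\<close>. The slope is largest at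
  \<open>\<theta>\<^sub>0\<close>, so by the mean value theorem that value is below \<open>cgf1 0 ^ (p - 1)\<close>, which is
  \<open>1 / 2 ^ (p - 1)\<close> and hence at most \<open>1 / p\<close>.\<close>

lemma critical_point_above_line:
  assumes p: "3 \<le> p"
  shows "- beta1_crit \<mu> p < beta2_crit \<mu> p"
proof -
  let ?g = "slope \<theta>\<^sub>0" and ?S = "cgf1 \<theta>\<^sub>0 ^ (p - 1)"
  have pos: "0 < ?g" "0 < cgf2 \<theta>\<^sub>0" "0 < real p - 1" "0 < real p"
    using slope_pos cgf2_pos p by auto
  obtain z where z: "0 < z" "z < \<theta>\<^sub>0" "?S - cgf1 0 ^ (p - 1) = \<theta>\<^sub>0 * ((real p - 1) * slope z)"
    using MVT2[OF theta0_pos[OF p] power_cgf1_has_derivative] by auto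
  have "?S - cgf1 0 ^ (p - 1) < \<theta>\<^sub>0 * ((real p - 1) * ?g)"
    unfolding z(3) using slope_strict_mono[of z \<theta>\<^sub>0] z theta0_pos[OF p] pos by simp
  moreover have "cgf1 0 ^ (p - 1) \<le> 1 / real p"
  proof -
    have "real p \<le> 2 ^ (p - 1)"
      using less_exp[of "p - 1"] p by (metis Suc_leI Suc_pred' less_le_trans numeral_eq_Suc of_nat_le_iff of_nat_numeral of_nat_power zero_less_Suc)
    then show ?thesis using p by (simp add: cgf1_0 power_one_over frac_le)
  qed
  ultimately have "?S < 1 / real p + \<theta>\<^sub>0 * ((real p - 1) * ?g)" by linarith
  then have "?S / (2 * (real p - 1) * ?g) < (1 / real p + \<theta>\<^sub>0 * ((real p - 1) * ?g)) / (2 * (real p - 1) * ?g)"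
    using pos by (intro divide_strict_right_mono) auto
  also have "\<dots> = beta2_crit \<mu> p + \<theta>\<^sub>0 / 2"
    unfolding beta2_crit_eq using pos by (simp add: field_simps)
  finally have "?S / (2 * (real p - 1) * ?g) < beta2_crit \<mu> p + \<theta>\<^sub>0 / 2" .
  moreover have "?S / (2 * (real p - 1) * ?g) = cgf1 \<theta>\<^sub>0 / (2 * (real p - 1) * cgf2 \<theta>\<^sub>0)"
    using pos power_cgf1_eq[of \<theta>\<^sub>0] by (simp add: field_simps)
  ultimately show ?thesis by (simp add: beta1_crit_eq)
qed

section \<open>The transition curve and the line\<close>

lemma transition_r_above_line:
  assumes H: "single_edge H1" "num_edges H2 = p" and p: "3 \<le> p" and b1: "\<beta>1 \<le> beta1_crit \<mu> p"
  shows "- \<beta>1 < transition_r \<mu> H1 H2 \<beta>1"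
proof (cases "\<beta>1 < beta1_crit \<mu> p")
  case True
  then obtain \<beta>2 where "two_maximizers \<beta>1 \<beta>2" using two_maximizers_exist by blast
  then show ?thesis
    using transition_r_eq[OF H _ True] two_maximizers_above_line[OF p] by simp
next
  case False
  then show ?thesis
    using b1 critical_point_above_line[OF p] by (simp add: transition_r_def H(2))
qed

lemma transition_r_quadratic:
  assumes H: "single_edge H1" "num_edges H2 = p" and p: "p = 2" and b1: "\<beta>1 \<le> beta1_crit \<mu> p"
  shows "transition_r \<mu> H1 H2 \<beta>1 = - \<beta>1"
proof (cases "\<beta>1 < beta1_crit \<mu> p")
  case True
  show ?thesis by (rule transition_r_eq[OF H two_maximizers_quadratic[OF p True] True])
next
  case False
  then show ?thesis
    using b1 beta_crit_quadratic[OF p] by (simp add: transition_r_def H(2))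
qed

end

theorem proposition2:
  fixes \<mu> :: "real measure"
    and P :: "'w measure" and X :: "'w \<Rightarrow> real"
    and H1 :: "'a graph" and H2 :: "'b graph" and p :: nat
  assumes "real_distribution \<mu>"
    and supported: "AE x in \<mu>. x \<in> {0..1}"
    and symmetric: "distr \<mu> borel (\<lambda>x. 1 - x) = \<mu>"
    and nondegenerate: "\<not> (\<exists>c. AE x in \<mu>. x = c)"
    and "prob_space P" and "X \<in> borel_measurable P" and "distr P borel X = \<mu>"
    and "single_edge H1"
    and "finite_simple_graph H2" and "num_edges H2 = p" and "p \<ge> 2"
    and "\<exists>!\<theta>::real. critical_eq \<mu> p \<theta>"
  shows "(p \<ge> 3 \<longrightarrow> (\<forall>(\<beta>1, \<beta>2) \<in> phase_transition_curve \<mu> H1 H2. \<beta>2 > - \<beta>1))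
       \<and> (p = 2 \<longrightarrow> phase_transition_curve \<mu> H1 H2
            = {(\<beta>1, \<beta>2). \<beta>2 = - \<beta>1 \<and> \<beta>1 \<le> - 1 / (4 * prob_space.variance P X)})"
proof -
  interpret real_distribution \<mu> by fact
  interpret edge_weight_model \<mu> p
    by unfold_locales fact+
  have X: "integral\<^sup>L P (\<lambda>w. f (X w)) = integral\<^sup>L \<mu> f" if "f \<in> borel_measurable borel" for f :: "real \<Rightarrow> real"
    using integral_distr[OF assms(6) that] assms(7) by simp
  have "prob_space.variance P X = cgf2 0"
    unfolding cgf2_0 by (simp add: X[of "\<lambda>x. x"] X[of "\<lambda>x. (x - expectation (\<lambda>x. x))\<^sup>2"])
  then show ?thesis
    using transition_r_above_line[OF \<open>single_edge H1\<close> \<open>num_edges H2 = p\<close>]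
      transition_r_quadratic[OF \<open>single_edge H1\<close> \<open>num_edges H2 = p\<close>] beta_crit_quadratic(1)
    unfolding phase_transition_curve_def \<open>num_edges H2 = p\<close>
    by auto
qed

end
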